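(* Let $q$ be a prime power, let $\mathbf F_q$ be the finite field with $q$ elements, and let $n>1$ be an integer. If $\gcd(q,n)=1$, then the number of blocks in the extension graph of degree $n$ over $\mathbf F_q$ is $$\frac{1}{nq}\sum_{d\mid n}\mu(d)\,q^{n/d},$$ where $\mu$ is the Möbius function.
   Context: The vertices of the extension graph of degree $n$ over $\mathbf F_q$ are all the monic irreducible polynomials of degree $n$ over $\mathbf F_q$. The block of such a polynomial $f$ is the set $\{f(x+b): b\in\mathbf F_q\}$; the blocks partition the set of vertices. *)

theory Defs
  imports
    "HOL-Computational_Algebra.Computational_Algebra"
    "HOL-Number_Theory.Number_Theory"
begin

definition moebius_mu :: "nat \<Rightarrow> int" where
  "moebius_mu n = (if squarefree n then (- 1) ^ card (prime_factors n) else 0)"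

(* Only the vertex set of the extension graph and its partition into blocks are needed;
   the edges play no role in counting blocks. *)
definition extension_graph_vertices :: "nat \<Rightarrow> 'a :: field poly set" where
  "extension_graph_vertices n = {f. lead_coeff f = 1 \<and> irreducible f \<and> degree f = n}"

(* f \<circ>\<^sub>p [:b, 1:] is f(x + b). *)
definition block :: "'a :: field poly \<Rightarrow> 'a poly set" where
  "block f = {f \<circ>\<^sub>p [:b, 1:] | b. b \<in> UNIV}"

definition extension_graph_blocks :: "nat \<Rightarrow> 'a :: field poly set set" where
  "extension_graph_blocks n = block ` extension_graph_vertices n"

end

theory Submission
  imports Defs "HOL-Library.Cardinality"
begin

text \<open>
  Let \<open>N d\<close> be the number of monic irreducible polynomials of degree \<open>d\<close>. The degree of a monic \<open>f\<close> is the
  sum of \<open>deg p\<close> over all pairs of a monic irreducible \<open>p\<close> and \<open>k \<ge> 1\<close> with \<open>p ^ k\<close> dividing \<open>f\<close>.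
  Summing over the \<open>q ^ n\<close> monic \<open>f\<close> of degree \<open>n\<close>, of which \<open>q ^ (n - m)\<close> are divisible by a given monic
  polynomial of degree \<open>m \<le> n\<close>, gives \<open>n q ^ n = (\<Sum>m=1..n. c m q ^ (n - m))\<close> with
  \<open>c m = (\<Sum>d | d dvd m. d N d)\<close>. Subtracting \<open>q\<close> times the identity for \<open>n - 1\<close> leaves \<open>c n = q ^ n\<close>,
  and Moebius inversion yields \<open>n N n\<close>; no field extension is needed.

  Every block has exactly \<open>q\<close> elements, because the substitution of \<open>x + b\<close> adds \<open>n b\<close> to the coefficient
  of degree \<open>n - 1\<close> and \<open>n\<close> is invertible in the field.
\<close>

section \<open>Moebius inversion\<close>

text \<open>Coprimality leaves squarefreeness unchanged, and the one additional prime factor flips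
  the sign; if \<open>d\<close> is not squarefree, both sides are 0.\<close>

lemma moebius_mu_prime_mult:
  assumes "prime p" "\<not> p dvd d"
  shows "moebius_mu (p * d) = - moebius_mu d"
proof -
  have "d \<noteq> 0" using assms by (auto intro: ccontr)
  have cop: "coprime p d" using assms by (simp add: prime_imp_coprime)
  have sf: "squarefree (p * d) \<longleftrightarrow> squarefree d"
    using squarefree_mult_coprime[OF cop] squarefree_prime[OF assms(1)] squarefree_multD(2)
    by blast
  have "prime_factors (p * d) = insert p (prime_factors d)"
    using assms \<open>d \<noteq> 0\<close> by (auto simp: prime_factors_product prime_prime_factors)
  moreover have "p \<notin> prime_factors d" using assms by auto
  ultimately show ?thesis
    by (simp add: moebius_mu_def sf)
qed

text \<open>Multiplication by a prime divisor of \<open>n\<close> pairs off the squarefree divisors with opposite signs.\<close>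
lemma sum_moebius_mu:
  assumes "n > (0::nat)"
  shows "(\<Sum>d | d dvd n. moebius_mu d) = (if n = 1 then 1 else 0)"
proof (cases "n = 1")
  case True
  then show ?thesis by (simp add: moebius_mu_def)
next
  case False
  then obtain p where p: "prime p" "p dvd n" using prime_factor_nat by blast
  \<comment> \<open>\<open>A\<close> and its image under multiplication by \<open>p\<close> are
    disjoint and exhaust the squarefree divisors of \<open>n\<close>; every other divisor
    contributes 0.\<close>
  define A where "A = {d. d dvd n \<and> squarefree d \<and> \<not> p dvd d}"
  have fin: "finite {d. d dvd n}" using assms by simp
  have finA: "finite A" by (rule finite_subset[OF _ fin]) (auto simp: A_def)
  have sub: "A \<union> (*) p ` A \<subseteq> {d. d dvd n}"
  proof -
    have "p * d dvd n" if "d \<in> A" for d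
      using that p by (intro divides_mult) (simp_all add: A_def prime_imp_coprime)
    then show ?thesis by (auto simp: A_def)
  qed
  have zero: "moebius_mu d = 0" if d: "d \<in> {d. d dvd n} - (A \<union> (*) p ` A)" for d
  proof (rule ccontr)
    assume "moebius_mu d \<noteq> 0"
    then have sf: "squarefree d" by (metis moebius_mu_def)
    have "p dvd d" using d sf by (simp add: A_def)
    then obtain e where e: "d = p * e" by (rule dvdE)
    have "\<not> p dvd e"
    proof
      assume "p dvd e"
      then have "p ^ 2 dvd d" by (simp add: e power2_eq_square)
      from squarefreeD[OF sf this] p(1) show False by (simp add: prime_nat_iff)
    qed
    moreover have "squarefree e" using sf squarefree_multD(2) unfolding e by blast
    moreover have "e dvd n" using d unfolding e by (blast dest: dvd_mult_right)
    ultimately have "e \<in> A" by (simp add: A_def)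
    with d e show False by blast
  qed
  have "(\<Sum>d | d dvd n. moebius_mu d) = (\<Sum>d\<in>A \<union> (*) p ` A. moebius_mu d)"
    using zero by (intro sum.mono_neutral_right fin sub) blast
  also have "\<dots> = (\<Sum>d\<in>A. moebius_mu d) + (\<Sum>d\<in>(*) p ` A. moebius_mu d)"
    by (intro sum.union_disjoint finA finite_imageI) (auto simp: A_def)
  also have "(\<Sum>d\<in>(*) p ` A. moebius_mu d) = (\<Sum>d\<in>A. moebius_mu (p * d))"
    using p(1) by (subst sum.reindex) (auto intro!: inj_onI)
  also have "\<dots> = (\<Sum>d\<in>A. - moebius_mu d)"
    using p(1) by (intro sum.cong) (auto simp: A_def moebius_mu_prime_mult)
  finally show ?thesis using False by (simp add: sum_negf)
qed

text \<open>Expanding \<open>g\<close> gives a sum over pairs with \<open>d * e\<close> dividing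
  \<open>n\<close>; after exchanging the order, the inner sum of Moebius values vanishes unless
  \<open>e = n\<close>.\<close>

lemma moebius_inversion:
  fixes f g :: "nat \<Rightarrow> int"
  assumes "n > 0" and sum_f: "\<And>m. m > 0 \<Longrightarrow> (\<Sum>d | d dvd m. f d) = g m"
  shows "(\<Sum>d | d dvd n. moebius_mu d * g (n div d)) = f n"
proof -
  have div0: "n div d > 0" if "d dvd n" for d
    using assms(1) that by (auto elim!: dvdE)
  have fin: "finite {d. d dvd n}" using assms(1) by simp
  have "(\<Sum>d | d dvd n. moebius_mu d * g (n div d)) =
      (\<Sum>d | d dvd n. \<Sum>e | e dvd n div d. moebius_mu d * f e)"
    by (intro sum.cong) (auto simp flip: sum_f[OF div0] simp: sum_distrib_left)
  \<comment> \<open>The redundant condition \<open>e dvd n\<close> gives both indices the same fixed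
    range, so that only \<open>d * e dvd n\<close> links them when the sums are swapped.\<close>
  also have "\<dots> = (\<Sum>d | d dvd n. \<Sum>e | e dvd n \<and> d * e dvd n. moebius_mu d * f e)"
    using assms(1) by (intro sum.cong refl) (auto elim!: dvdE intro: dvd_mult_right)
  also have "\<dots> = (\<Sum>e | e dvd n. \<Sum>d | d dvd n \<and> d * e dvd n. moebius_mu d * f e)"
    using sum.swap_restrict[OF fin fin, of "\<lambda>d e. moebius_mu d * f e" "\<lambda>d e. d * e dvd n"] by simp
  also have "\<dots> = (\<Sum>e | e dvd n. f e * (\<Sum>d | d dvd n div e. moebius_mu d))"
    unfolding sum_distrib_left using assms(1)
    by (intro sum.cong refl) (auto elim!: dvdE simp: mult.commute intro: dvd_mult_right)
  also have "\<dots> = (\<Sum>e | e dvd n. if e = n then f e else 0)"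
  proof (intro sum.cong refl)
    fix e assume "e \<in> {e. e dvd n}"
    then have "n div e = 1 \<longleftrightarrow> e = n" using assms(1) by (auto elim!: dvdE)
    then show "f e * (\<Sum>d | d dvd n div e. moebius_mu d) = (if e = n then f e else 0)"
      using \<open>e \<in> _\<close> by (simp add: sum_moebius_mu div0)
  qed
  also have "\<dots> = f n" using fin by simp
  finally show ?thesis .
qed

section \<open>Counting monic polynomials\<close>

definition monic_polys :: "nat \<Rightarrow> 'a :: field poly set" where
  "monic_polys n = {f. lead_coeff f = 1 \<and> degree f = n}"

lemma monic_polys_0: "monic_polys 0 = {1}"
proof -
  have "f = 1" if "lead_coeff f = 1" "degree f = 0" for f :: "'a poly"
    using that degree_0_id[of f] by (simp add: one_pCons)
  then show ?thesis by (auto simp: monic_polys_def)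
qed

lemma pCons_in_monic_polys_Suc: "pCons a p \<in> monic_polys (Suc n) \<longleftrightarrow> p \<in> monic_polys n"
  by (cases "p = 0") (simp_all add: monic_polys_def)

text \<open>Splitting off the constant coefficient sets up the inductions for finiteness and for the
  count \<open>q ^ n\<close>.\<close>

lemma monic_polys_Suc: "monic_polys (Suc n) = (\<lambda>(a, p). pCons a p) ` (UNIV \<times> monic_polys n)"
proof (intro equalityI subsetI)
  fix f :: "'a poly" assume f: "f \<in> monic_polys (Suc n)"
  obtain a p where "f = pCons a p" by (cases f)
  with f show "f \<in> (\<lambda>(a, p). pCons a p) ` (UNIV \<times> monic_polys n)"
    by (auto simp: pCons_in_monic_polys_Suc)
qed (auto simp: pCons_in_monic_polys_Suc)

lemma finite_monic_polys: "finite (monic_polys n :: 'a :: {field, finite} poly set)"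
  by (induction n) (auto simp: monic_polys_0 monic_polys_Suc)

lemma card_monic_polys: "card (monic_polys n :: 'a :: {field, finite} poly set) = CARD('a) ^ n"
proof (induction n)
  case (Suc n)
  have "card (monic_polys (Suc n) :: 'a poly set) = card ((UNIV :: 'a set) \<times> (monic_polys n :: 'a poly set))"
    unfolding monic_polys_Suc by (rule card_image) (auto intro!: inj_onI)
  with Suc show ?case by (simp add: card_cartesian_product)
qed (simp add: monic_polys_0)

text \<open>The cofactor of \<open>g\<close> in a monic multiple is monic of degree
  \<open>n - m\<close>, and multiplication by \<open>g\<close> is injective.\<close>

lemma card_monic_polys_dvd:
  fixes g :: "'a :: {field, finite} poly"
  assumes "g \<in> monic_polys m"
  shows "card {f \<in> monic_polys n. g dvd f} = (if m \<le> n then CARD('a) ^ (n - m) else 0)"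
proof -
  have g: "g \<noteq> 0" "lead_coeff g = 1" "degree g = m" using assms by (auto simp: monic_polys_def)
  have dvd: "\<exists>h\<in>monic_polys (n - m). f = g * h" "m \<le> n"
    if f: "f \<in> monic_polys n" "g dvd f" for f
  proof -
    obtain h where h: "f = g * h" using f by auto
    have "f \<noteq> 0" using f by (auto simp: monic_polys_def)
    with h have "h \<noteq> 0" by auto
    then have "n = m + degree h" "lead_coeff h = 1"
      using f h g by (auto simp: monic_polys_def degree_mult_eq coeff_mult_degree_sum)
    then show "\<exists>h\<in>monic_polys (n - m). f = g * h" "m \<le> n"
      using h by (auto simp: monic_polys_def)
  qed
  show ?thesis
  proof (cases "m \<le> n")
    case True
    have "{f \<in> monic_polys n. g dvd f} = (*) g ` monic_polys (n - m)"
    proof (intro equalityI subsetI)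
      fix f assume "f \<in> (*) g ` monic_polys (n - m)"
      then obtain h where h: "f = g * h" "h \<in> monic_polys (n - m)" by auto
      then have "h \<noteq> 0" "lead_coeff h = 1" "degree h = n - m" by (auto simp: monic_polys_def)
      then have "lead_coeff f = 1" "degree f = n"
        using h(1) g True by (simp_all only: lead_coeff_mult) (simp_all add: degree_mult_eq)
      then have "f \<in> monic_polys n" by (simp add: monic_polys_def)
      then show "f \<in> {f \<in> monic_polys n. g dvd f}" using h by simp
    qed (use dvd in blast)
    moreover have "card ((*) g ` monic_polys (n - m)) = card (monic_polys (n - m) :: 'a poly set)"
      using g by (intro card_image) (auto intro!: inj_onI)
    ultimately show ?thesis using True by (simp add: card_monic_polys)
  next
    case False
    then have "{f \<in> monic_polys n. g dvd f} = {}" using dvd by blast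
    with False show ?thesis by (simp del: empty_Collect_eq Collect_empty_eq)
  qed
qed

section \<open>Counting monic irreducible polynomials\<close>

lemma finite_extension_graph_vertices:
  "finite (extension_graph_vertices n :: 'a :: {field, finite} poly set)"
  by (rule finite_subset[OF _ finite_monic_polys[of n]])
    (auto simp: extension_graph_vertices_def monic_polys_def)

text \<open>The cofactor is a unit because \<open>p\<close> is not, hence a constant; comparing
  leading coefficients shows that it is 1.\<close>

lemma monic_dvd_imp_eq:
  fixes p r :: "'a :: field poly"
  assumes "irreducible p" "irreducible r" "lead_coeff p = 1" "lead_coeff r = 1" "p dvd r"
  shows "p = r"
proof -
  obtain c where c: "r = p * c" using assms(5) by auto
  then have "is_unit c" using assms(1,2) irreducibleD[OF assms(2) c] by (auto simp: irreducible_def)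
  then obtain a where a: "c = [:a:]" by (auto simp: is_unit_poly_iff)
  with assms c show ?thesis by (auto split: if_splits)
qed

text \<open>An irreducible \<open>f\<close> only needs scaling; a reducible one has a nonconstant
  factor of smaller degree, to which the induction hypothesis applies.\<close>

lemma ex_monic_irreducible_dvd:
  fixes f :: "'a :: field poly"
  assumes "degree f > 0"
  shows "\<exists>p. lead_coeff p = 1 \<and> irreducible p \<and> p dvd f"
  using assms
proof (induction "degree f" arbitrary: f rule: less_induct)
  case less
  then have [simp]: "f \<noteq> 0" by auto
  show ?case
  proof (cases "irreducible f")
    case True
    let ?c = "inverse (lead_coeff f)"
    have u: "is_unit [:?c:]" by (simp add: is_unit_iff_degree)
    have "irreducible (Polynomial.smult ?c f)"
      using True irreducible_mult_unit_left[OF u, of f] by simp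
    moreover have "Polynomial.smult ?c f dvd f" by (simp add: smult_dvd_iff)
    moreover have "lead_coeff (Polynomial.smult ?c f) = 1" by simp
    ultimately show ?thesis by blast
  next
    case False
    moreover have "\<not> is_unit f" using less.prems by (auto simp: is_unit_iff_degree)
    ultimately obtain a b where ab: "f = a * b" "\<not> is_unit a" "\<not> is_unit b"
      unfolding irreducible_def by auto
    then have "a \<noteq> 0" "b \<noteq> 0" using \<open>f \<noteq> 0\<close> by auto
    with ab have "degree a > 0" "degree a < degree f"
      by (auto simp: is_unit_iff_degree degree_mult_eq)
    from less.hyps[OF this(2,1)] ab(1) show ?thesis by (metis dvd_mult2)
  qed
qed

section \<open>Multiplicities of irreducible factors\<close>

lemma degree_power_le_of_dvd:
  fixes p f :: "'a :: field poly"
  assumes "p ^ k dvd f" "f \<noteq> 0"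
  shows "k * degree p \<le> degree f"
  using dvd_imp_degree_le[OF assms] assms by (cases "p = 0") (auto simp: degree_power_eq)

text \<open>The set consists of the exponents from 1 up to the multiplicity of \<open>p\<close> in
  \<open>f\<close>, so its cardinality serves as that multiplicity.\<close>

lemma finite_power_dvd:
  fixes p f :: "'a :: field poly"
  assumes "degree p > 0" "f \<noteq> 0"
  shows "finite {k. 0 < k \<and> p ^ k dvd f}"
proof (rule finite_subset)
  show "{k. 0 < k \<and> p ^ k dvd f} \<subseteq> {..degree f}"
    using degree_power_le_of_dvd[OF _ assms(2)] assms(1)
    by auto (metis Suc_leI le_trans mult.right_neutral mult_le_mono2 One_nat_def)
qed simp

lemma card_power_dvd_mult_self:
  fixes p g :: "'a :: field poly"
  assumes "degree p > 0" "g \<noteq> 0"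
  shows "card {k. 0 < k \<and> p ^ k dvd p * g} = Suc (card {k. 0 < k \<and> p ^ k dvd g})"
proof -
  have "p \<noteq> 0" using assms by auto
  have *: "p ^ Suc k dvd p * g \<longleftrightarrow> p ^ k dvd g" for k
    using \<open>p \<noteq> 0\<close> by simp
  \<comment> \<open>Cancelling one \<open>p\<close> lowers each exponent by one; the inserted 0
    accounts for exponent 1 on the left.\<close>
  have "{k. 0 < k \<and> p ^ k dvd p * g} = Suc ` insert 0 {k. 0 < k \<and> p ^ k dvd g}"
  proof (rule Set.set_eqI)
    show "k \<in> {k. 0 < k \<and> p ^ k dvd p * g} \<longleftrightarrow> k \<in> Suc ` insert 0 {k. 0 < k \<and> p ^ k dvd g}" for k
      using * by (cases k; cases "k - 1") (simp_all add: image_iff del: power_Suc)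
  qed
  moreover have "card \<dots> = card (insert 0 {k. 0 < k \<and> p ^ k dvd g})"
    by (intro card_image inj_Suc)
  ultimately show ?thesis using finite_power_dvd[OF assms] by (simp del: image_insert)
qed

text \<open>Removing one monic irreducible factor \<open>r\<close> lowers only the multiplicity of
  \<open>r\<close>, by one, and lowers both sides by \<open>degree r\<close>. A free bound
  \<open>N\<close> lets the induction hypothesis for the cofactor use the same range.\<close>

lemma degree_eq_sum_power_dvd:
  fixes f :: "'a :: {field, finite} poly"
  assumes "f \<noteq> 0" "degree f \<le> N"
  shows "degree f = (\<Sum>d=1..N. \<Sum>p\<in>extension_graph_vertices d. d * card {k. 0 < k \<and> p ^ k dvd f})"
  using assms
proof (induction "degree f" arbitrary: f rule: less_induct)
  case less
  show ?case
  proof (cases "degree f = 0")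
    case True
    have "{k. 0 < k \<and> p ^ k dvd f} = {}" if "d \<in> {1..N}" "p \<in> extension_graph_vertices d" for d p
      using degree_power_le_of_dvd[of p _ f] that less.prems True
      by (auto simp: extension_graph_vertices_def)
    then have "(\<Sum>d=1..N. \<Sum>p\<in>extension_graph_vertices d. d * card {k. 0 < k \<and> p ^ k dvd f}) = 0"
      by (intro sum.neutral ballI) (simp only: card.empty)
    then show ?thesis using True by simp
  next
    case False
    then obtain r where r: "lead_coeff r = 1" "irreducible r" "r dvd f"
      using ex_monic_irreducible_dvd by auto
    then obtain g where g: "f = r * g" by auto
    then have "r \<noteq> 0" "g \<noteq> 0" using less.prems by auto
    have "degree r > 0" using r(2) \<open>r \<noteq> 0\<close> by (auto simp: irreducible_def is_unit_iff_degree)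
    have deg: "degree f = degree r + degree g" using g \<open>r \<noteq> 0\<close> \<open>g \<noteq> 0\<close> by (simp add: degree_mult_eq)
    have step: "card {k. 0 < k \<and> p ^ k dvd f} = card {k. 0 < k \<and> p ^ k dvd g} + (if p = r then 1 else 0)"
      if p: "p \<in> extension_graph_vertices d" for d and p :: "'a poly"
    proof (cases "p = r")
      case True
      then show ?thesis using card_power_dvd_mult_self[OF \<open>degree r > 0\<close> \<open>g \<noteq> 0\<close>] g by simp
    next
      case False
      then have "\<not> p dvd r" using monic_dvd_imp_eq[of p r] r p by (auto simp: extension_graph_vertices_def)
      moreover have "prime_elem p" 
        using p by (auto simp: extension_graph_vertices_def intro: field_poly_irreducible_imp_prime)
      ultimately have "p ^ k dvd f \<longleftrightarrow> p ^ k dvd g" for k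
        using prime_power_dvd_multD[of p k r g] g by (cases "k = 0") auto
      then show ?thesis using False by simp
    qed
    have "degree r \<in> {1..N}" using deg less.prems \<open>degree r > 0\<close> by auto
    have "r \<in> extension_graph_vertices (degree r)" using r by (simp add: extension_graph_vertices_def)
    have "(\<Sum>d=1..N. \<Sum>p\<in>extension_graph_vertices d. d * card {k. 0 < k \<and> p ^ k dvd f}) =
        (\<Sum>d=1..N. \<Sum>p\<in>extension_graph_vertices d. d * card {k. 0 < k \<and> p ^ k dvd g}) +
        (\<Sum>d=1..N. \<Sum>p\<in>extension_graph_vertices d. if p = r then d else 0)"
      unfolding sum.distrib[symmetric] by (intro sum.cong refl) (simp add: step)
    \<comment> \<open>Only the index \<open>d = degree r\<close> has a vertex set that contains
      \<open>r\<close>.\<close>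
    also have "(\<Sum>d=1..N. \<Sum>p\<in>extension_graph_vertices d. if p = r then d else 0) =
        (\<Sum>d=1..N. if d = degree r then d else 0)"
      using r by (intro sum.cong refl)
        (auto simp: finite_extension_graph_vertices, auto simp: extension_graph_vertices_def)
    also have "\<dots> = degree r" using \<open>degree r \<in> _\<close> by simp
    also have "(\<Sum>d=1..N. \<Sum>p\<in>extension_graph_vertices d. d * card {k. 0 < k \<and> p ^ k dvd g}) = degree g"
      using less.hyps[of g] \<open>g \<noteq> 0\<close> \<open>degree r > 0\<close> deg less.prems by simp
    finally show ?thesis using deg by simp
  qed
qed

lemma sum_degree_monic_polys:
  fixes c :: "nat \<Rightarrow> nat"
  defines "c \<equiv> \<lambda>m. \<Sum>d | d dvd m. d * card (extension_graph_vertices d :: 'a :: {field, finite} poly set)"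
  shows "n * CARD('a) ^ n = (\<Sum>m=1..n. c m * CARD('a) ^ (n - m))"
proof -
  let ?V = "extension_graph_vertices :: nat \<Rightarrow> 'a poly set"
  let ?M = "monic_polys n :: 'a poly set"
  have "n * CARD('a) ^ n = (\<Sum>f\<in>?M. n)" by (simp add: card_monic_polys)
  also have "\<dots> = (\<Sum>f\<in>?M. \<Sum>d=1..n. \<Sum>p\<in>?V d. d * card {k. 0 < k \<and> p ^ k dvd f})"
  proof (intro sum.cong refl)
    fix f assume "f \<in> ?M"
    then have "f \<noteq> 0" "degree f = n" by (auto simp: monic_polys_def)
    then show "n = (\<Sum>d=1..n. \<Sum>p\<in>?V d. d * card {k. 0 < k \<and> p ^ k dvd f})"
      using degree_eq_sum_power_dvd[of f n] by simp
  qed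
  \<comment> \<open>As \<open>d\<close> is at least 1, exponents stay within \<open>n\<close>; a
    range independent of \<open>f\<close> allows the sum over \<open>f\<close> to move
    inside.\<close>
  also have "\<dots> = (\<Sum>f\<in>?M. \<Sum>d=1..n. \<Sum>p\<in>?V d. \<Sum>k=1..n. if p ^ k dvd f then d else 0)"
  proof (intro sum.cong refl)
    fix f :: "'a poly" and d p assume *: "f \<in> ?M" "d \<in> {1..n}" "p \<in> ?V d"
    have "f \<noteq> 0" using *(1) by (auto simp: monic_polys_def)
    have "k \<le> n" if "p ^ k dvd f" for k
    proof -
      have "k * d \<le> n" using degree_power_le_of_dvd[OF that \<open>f \<noteq> 0\<close>] *
        by (auto simp: monic_polys_def extension_graph_vertices_def)
      moreover have "k \<le> k * d" using *(2) by (cases d) auto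
      ultimately show ?thesis by (rule le_trans[rotated])
    qed
    then have "{k. 0 < k \<and> p ^ k dvd f} = {k\<in>{1..n}. p ^ k dvd f}" by auto
    then show "d * card {k. 0 < k \<and> p ^ k dvd f} = (\<Sum>k=1..n. if p ^ k dvd f then d else 0)"
      by (simp flip: sum.inter_filter)
  qed
  also have "\<dots> = (\<Sum>d=1..n. \<Sum>p\<in>?V d. \<Sum>k=1..n. \<Sum>f\<in>?M. if p ^ k dvd f then d else 0)"
    by (rule trans[OF sum.swap], rule sum.cong[OF refl], rule trans[OF sum.swap],
        rule sum.cong[OF refl], rule sum.swap)
  also have "\<dots> = (\<Sum>d=1..n. \<Sum>p\<in>?V d. \<Sum>k=1..n. if d * k \<le> n then d * CARD('a) ^ (n - d * k) else 0)"
  proof (intro sum.cong refl)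
    fix d p k assume p: "p \<in> ?V d"
    have "p ^ k \<in> monic_polys (d * k)"
      using p lead_coeff_power[of p k] degree_power_eq[of p k]
      by (auto simp: monic_polys_def extension_graph_vertices_def irreducible_def mult.commute)
    from card_monic_polys_dvd[OF this, of n]
    show "(\<Sum>f\<in>?M. if p ^ k dvd f then d else 0) = (if d * k \<le> n then d * CARD('a) ^ (n - d * k) else 0)"
      by (simp add: finite_monic_polys flip: sum.inter_filter)
  qed
  also have "\<dots> = (\<Sum>d=1..n. \<Sum>k=1..n. if d * k \<le> n then d * card (?V d) * CARD('a) ^ (n - d * k) else 0)"
    by (intro sum.cong refl) (simp add: sum_distrib_left, intro sum.cong refl, simp)
  \<comment> \<open>The new index \<open>m = d * k\<close> is the degree of
    \<open>p ^ k\<close>.\<close>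
  also have "\<dots> = (\<Sum>d=1..n. \<Sum>m | m \<in> {1..n} \<and> d dvd m. d * card (?V d) * CARD('a) ^ (n - m))"
  proof (rule sum.cong[OF refl])
    fix d assume d: "d \<in> {1..n}"
    have "(\<Sum>k=1..n. if d * k \<le> n then d * card (?V d) * CARD('a) ^ (n - d * k) else 0) =
        (\<Sum>k | k \<in> {1..n} \<and> d * k \<le> n. d * card (?V d) * CARD('a) ^ (n - d * k))"
      by (subst sum.inter_filter[symmetric]) auto
    also have "\<dots> = (\<Sum>m | m \<in> {1..n} \<and> d dvd m. d * card (?V d) * CARD('a) ^ (n - m))"
    proof (rule sum.reindex_bij_witness[where j = "\<lambda>k. d * k" and i = "\<lambda>m. m div d"])
      fix k assume "k \<in> {k \<in> {1..n}. d * k \<le> n}"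
      then show "d * k \<in> {m \<in> {1..n}. d dvd m}" using d by auto
    next
      fix m assume "m \<in> {m \<in> {1..n}. d dvd m}"
      then obtain k where k: "m = d * k" "1 \<le> m" "m \<le> n" by auto
      moreover have "1 \<le> k" using k by (cases k) auto
      moreover have "k \<le> n"
      proof (rule le_trans)
        show "k \<le> d * k" using d by (cases d) auto
        show "d * k \<le> n" using k by simp
      qed
      ultimately show "m div d \<in> {k \<in> {1..n}. d * k \<le> n}" using d by simp
    qed (use d in auto)
    finally show "(\<Sum>k=1..n. if d * k \<le> n then d * card (?V d) * CARD('a) ^ (n - d * k) else 0) = \<dots>" .
  qed
  also have "\<dots> = (\<Sum>m=1..n. \<Sum>d | d \<in> {1..n} \<and> d dvd m. d * card (?V d) * CARD('a) ^ (n - m))"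
    by (rule sum.swap_restrict) auto
  also have "\<dots> = (\<Sum>m=1..n. c m * CARD('a) ^ (n - m))"
  proof (rule sum.cong[OF refl])
    fix m assume m: "m \<in> {1..n}"
    then have "{d. d \<in> {1..n} \<and> d dvd m} = {d. d dvd m}"
      by (auto dest: dvd_imp_le dvd_pos_nat[rotated])
    then show "(\<Sum>d | d \<in> {1..n} \<and> d dvd m. d * card (?V d) * CARD('a) ^ (n - m)) = c m * CARD('a) ^ (n - m)"
      by (simp only: c_def sum_distrib_right)
  qed
  finally show ?thesis .
qed

text \<open>In the previous identity the term of index \<open>n\<close> has weight 1, so it can be
  isolated by comparison with the identity for \<open>n - 1\<close>.\<close>

lemma sum_card_extension_graph_vertices:
  assumes "n > 0"
  shows "(\<Sum>d | d dvd n. d * card (extension_graph_vertices d :: 'a :: {field, finite} poly set)) =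
    CARD('a) ^ n"
proof -
  obtain m where n: "n = Suc m" using assms gr0_implies_Suc by blast
  define c where "c k = (\<Sum>d | d dvd k. d * card (extension_graph_vertices d :: 'a poly set))" for k
  have *: "k * CARD('a) ^ k = (\<Sum>m=1..k. c m * CARD('a) ^ (k - m))" for k
    using sum_degree_monic_polys[of k, where 'a = 'a] by (simp add: c_def)
  have "n * CARD('a) ^ n = c n + (\<Sum>k=1..m. c k * CARD('a) ^ (n - k))"
    unfolding * by (simp add: n)
  also have "(\<Sum>k=1..m. c k * CARD('a) ^ (n - k)) = CARD('a) * (\<Sum>k=1..m. c k * CARD('a) ^ (m - k))"
    unfolding sum_distrib_left by (intro sum.cong refl) (auto simp: n Suc_diff_le)
  \<comment> \<open>With \<open>m = n - 1\<close>, what remains for \<open>c n\<close> is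
    \<open>n - m = 1\<close> copy of \<open>q ^ n\<close>.\<close>
  also have "\<dots> = m * CARD('a) ^ n" by (subst *[symmetric]) (simp add: n)
  finally show ?thesis by (simp add: n c_def)
qed

section \<open>Blocks\<close>

text \<open>Translations form an action of the additive group of the field; blocks are its
  orbits.\<close>

lemma pcompose_linear_add:
  fixes f :: "'a :: field poly"
  shows "(f \<circ>\<^sub>p [:a, 1:]) \<circ>\<^sub>p [:b, 1:] = f \<circ>\<^sub>p [:a + b, 1:]"
  by (simp add: pcompose_pCons flip: pcompose_assoc)

text \<open>Translation by \<open>b\<close> is multiplicative, preserves units and is undone by
  translation by \<open>- b\<close>, so a factorization of the translate pulls back to one of
  \<open>f\<close>.\<close>

lemma pcompose_linear_in_vertices:
  fixes f :: "'a :: field poly"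
  assumes "f \<in> extension_graph_vertices n"
  shows "f \<circ>\<^sub>p [:b, 1:] \<in> extension_graph_vertices n"
proof -
  have f: "lead_coeff f = 1" "irreducible f" "degree f = n"
    using assms by (auto simp: extension_graph_vertices_def)
  have inv: "(g \<circ>\<^sub>p [:b, 1:]) \<circ>\<^sub>p [:- b, 1:] = g" "(g \<circ>\<^sub>p [:- b, 1:]) \<circ>\<^sub>p [:b, 1:] = g"
    for g :: "'a poly"
    by (simp_all add: pcompose_linear_add)
  have unit: "is_unit (g \<circ>\<^sub>p [:a, 1:]) \<longleftrightarrow> is_unit g" for g :: "'a poly" and a
    by (cases "g = 0") (auto simp: is_unit_iff_degree degree_pcompose pcompose_eq_0_iff)
  have "irreducible (f \<circ>\<^sub>p [:b, 1:])"
  proof (rule irreducibleI)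
    show "f \<circ>\<^sub>p [:b, 1:] \<noteq> 0" using f by (auto simp: pcompose_eq_0_iff)
    show "\<not> is_unit (f \<circ>\<^sub>p [:b, 1:])" using f(2) by (simp add: unit irreducible_not_unit)
  next
    fix g h assume "f \<circ>\<^sub>p [:b, 1:] = g * h"
    then have "f = (g \<circ>\<^sub>p [:- b, 1:]) * (h \<circ>\<^sub>p [:- b, 1:])"
      using inv(1)[of f] by (simp add: pcompose_mult)
    from irreducibleD[OF f(2) this] show "is_unit g \<or> is_unit h" by (simp add: unit)
  qed
  then show ?thesis
    using f lead_coeff_comp[of "[:b, 1:]" f]
    by (simp add: extension_graph_vertices_def degree_pcompose)
qed

text \<open>Writing \<open>f = a + x p\<close> gives \<open>f(x + b) = a + (x + b) p(x + b)\<close>: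
  each induction step adds one more \<open>b\<close> times the leading coefficient.\<close>

lemma coeff_pcompose_linear_pred:
  fixes f :: "'a :: field poly"
  assumes "degree f = Suc m"
  shows "poly.coeff (f \<circ>\<^sub>p [:b, 1:]) m = poly.coeff f m + of_nat (Suc m) * b * lead_coeff f"
  using assms
proof (induction m arbitrary: f)
  case 0
  obtain a p where f: "f = pCons a p" by (cases f)
  with 0 have "degree p = 0" by (auto split: if_splits)
  then obtain c where "p = [:c:]" by (rule degree_eq_zeroE)
  with f 0 show ?case by (simp add: pcompose_pCons)
next
  case (Suc m)
  obtain a p where f: "f = pCons a p" by (cases f)
  have p: "degree p = Suc m" using Suc.prems f by (auto split: if_splits)
  have lead: "poly.coeff (p \<circ>\<^sub>p [:b, 1:]) (Suc m) = lead_coeff p"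
    using lead_coeff_comp[of "[:b, 1:]" p] p by (simp add: degree_pcompose)
  have "poly.coeff (f \<circ>\<^sub>p [:b, 1:]) (Suc m) = b * lead_coeff p + poly.coeff (p \<circ>\<^sub>p [:b, 1:]) m"
    using lead by (simp add: f pcompose_pCons)
  also have "\<dots> = poly.coeff f (Suc m) + of_nat (Suc (Suc m)) * b * lead_coeff f"
    using Suc.IH[OF p] p by (auto simp: f algebra_simps)
  finally show ?case .
qed

lemma card_block:
  fixes f :: "'a :: {field, finite} poly"
  assumes "lead_coeff f = 1" "of_nat (degree f) \<noteq> (0 :: 'a)"
  shows "card (block f) = CARD('a)"
proof -
  obtain m where m: "degree f = Suc m" using assms(2) by (cases "degree f") auto
  have "inj (\<lambda>b. f \<circ>\<^sub>p [:b, 1:])"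
  proof (rule injI)
    fix a b assume "f \<circ>\<^sub>p [:a, 1:] = f \<circ>\<^sub>p [:b, 1:]"
    \<comment> \<open>The coefficient just below the leading one already determines the
      shift.\<close>
    then have "poly.coeff (f \<circ>\<^sub>p [:a, 1:]) m = poly.coeff (f \<circ>\<^sub>p [:b, 1:]) m" by simp
    then have "of_nat (Suc m) * a = of_nat (Suc m) * b"
      unfolding coeff_pcompose_linear_pred[OF m] assms(1) by simp
    with assms(2) show "a = b" unfolding m by (metis mult_left_cancel)
  qed
  moreover have "block f = range (\<lambda>b. f \<circ>\<^sub>p [:b, 1:])" by (auto simp: block_def)
  ultimately show ?thesis by (simp add: card_image)
qed

lemma block_pcompose_linear:
  fixes f :: "'a :: field poly"
  shows "block (f \<circ>\<^sub>p [:a, 1:]) = block f"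
proof (intro equalityI subsetI)
  fix g assume "g \<in> block f"
  then obtain b where "g = f \<circ>\<^sub>p [:b, 1:]" by (auto simp: block_def)
  then have "g = (f \<circ>\<^sub>p [:a, 1:]) \<circ>\<^sub>p [:b - a, 1:]" by (simp add: pcompose_linear_add)
  then show "g \<in> block (f \<circ>\<^sub>p [:a, 1:])" by (auto simp: block_def)
qed (auto simp: block_def pcompose_linear_add)

lemma card_extension_graph_vertices_eq:
  assumes "of_nat n \<noteq> (0 :: 'a :: {field, finite})"
  shows "card (extension_graph_vertices n :: 'a poly set) =
    CARD('a) * card (extension_graph_blocks n :: 'a poly set set)"
proof -
  let ?V = "extension_graph_vertices n :: 'a poly set"
  let ?B = "extension_graph_blocks n :: 'a poly set set"
  have sub: "block f \<subseteq> ?V" if "f \<in> ?V" for f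
    using that pcompose_linear_in_vertices by (auto simp: block_def)
  have self: "f \<in> block f" for f :: "'a poly"
    \<comment> \<open>The shift \<open>b = 0\<close> is composition with the identity
      polynomial.\<close>
    using pcompose_idR[of f, symmetric] unfolding block_def by blast
  have "\<Union>?B = ?V" using sub self by (fastforce simp: extension_graph_blocks_def)
  moreover have "CARD('a) * card ?B = card (\<Union>?B)"
  proof (rule card_partition)
    show "finite ?B" by (simp add: extension_graph_blocks_def finite_extension_graph_vertices)
    show "finite (\<Union>?B)" using \<open>\<Union>?B = ?V\<close> by (simp add: finite_extension_graph_vertices)
    show "card C = CARD('a)" if "C \<in> ?B" for C
      using that card_block assms by (auto simp: extension_graph_blocks_def extension_graph_vertices_def)
    show "C \<inter> D = {}" if "C \<in> ?B" "D \<in> ?B" "C \<noteq> D" for C D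
    proof (rule ccontr)
      assume "C \<inter> D \<noteq> {}"
      then obtain g where "g \<in> C" "g \<in> D" by blast
      \<comment> \<open>A block is the orbit of each of its elements, so two blocks sharing
        \<open>g\<close> coincide.\<close>
      moreover have "block g = E" if "E \<in> ?B" "g \<in> E" for E
      proof -
        from that obtain f where E: "E = block f" by (auto simp: extension_graph_blocks_def)
        with that obtain b where "g = f \<circ>\<^sub>p [:b, 1:]" by (auto simp: block_def)
        with E show ?thesis by (simp add: block_pcompose_linear)
      qed
      ultimately show False using that by metis
    qed
  qed
  ultimately show ?thesis by simp
qed

theorem theorem5p1:
  fixes q n :: nat
  assumes "primepow q"
    and "card (UNIV :: 'a :: {field, finite} set) = q"
    and "n > 1"
    and "gcd q n = 1"
  shows "real (card (extension_graph_blocks n :: 'a poly set set)) =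
    1 / (real n * real q) * (\<Sum>d | d dvd n. real_of_int (moebius_mu d) * real q ^ (n div d))"
proof -
  \<comment> \<open>The characteristic divides \<open>q\<close>; if it also divided
    \<open>n\<close>, it would divide their gcd 1.\<close>
  have "of_nat n \<noteq> (0 :: 'a)"
  proof
    assume "of_nat n = (0 :: 'a)"
    then have "CHAR('a) dvd gcd q n"
      using CHAR_dvd_CARD[where 'a = 'a] assms(2) by (simp add: of_nat_eq_0_iff_char_dvd)
    with assms(4) have "of_nat 1 = (0 :: 'a)" unfolding of_nat_eq_0_iff_char_dvd by simp
    then show False by simp
  qed
  note blocks = card_extension_graph_vertices_eq[OF this]
  \<comment> \<open>Inversion is applied to the counts weighted by degree, whose divisor sums are
    the powers of \<open>q\<close>; \<open>f n\<close> is then \<open>n * q\<close> times the number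
    of blocks.\<close>
  define f where "f d = int (d * card (extension_graph_vertices d :: 'a poly set))" for d
  have "(\<Sum>d | d dvd m. f d) = int q ^ m" if "m > 0" for m
    using arg_cong[OF sum_card_extension_graph_vertices[OF that, where 'a = 'a], of int] assms(2)
    by (simp add: f_def)
  then have "(\<Sum>d | d dvd n. moebius_mu d * int q ^ (n div d)) = f n"
    using assms(3) by (intro moebius_inversion) auto
  from arg_cong[OF this, of real_of_int]
  have "(\<Sum>d | d dvd n. real_of_int (moebius_mu d) * real q ^ (n div d)) =
      real n * real q * real (card (extension_graph_blocks n :: 'a poly set set))"
    by (simp add: f_def blocks assms(2))
  moreover have "real n * real q \<noteq> 0" using assms(1,3) by (auto simp: primepow_gt_0_nat)
  ultimately show ?thesis by simp
qed

end
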